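(* There is a set $A$ of positive integers with natural density $1$, i.e. $\lim_{N\to\infty}\frac{1}{N}|A\cap[1,N]|=1$, such that $\ell(b)\sim b^2$ as $b\to\infty$ with $b\in A$ (that is, $\ell(b)/b^2\to 1$).
   Context: For an integer $b\geqslant 2$ and a set $S\subseteq \{0,1,\dots,b-1\}$, the Kempner set $\mathcal{K}(S,b)$ is the set of non-negative integers whose base-$b$ expansions use only digits from $S$. It is called proper if $0\in S$ and $S\neq\{0,1,\dots,b-1\}$. $\ell(b)$ denotes the length (number of terms) of the longest arithmetic progression (with nonzero common difference) contained in some proper Kempner set of base $b$. *)

theory Defs
  imports Complex_Main
begin

text \<open>The digits in the usual base-\<open>b\<close> expansion of \<open>n\<close>, without leading zeros;
  the expansion of 0 is the single digit 0.\<close>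

definition base_digits :: "nat \<Rightarrow> nat \<Rightarrow> nat set" where
  "base_digits b n = {(n div b ^ i) mod b |i. i = 0 \<or> b ^ i \<le> n}"

definition kempner :: "nat set \<Rightarrow> nat \<Rightarrow> nat set" where
  "kempner S b = {n. base_digits b n \<subseteq> S}"

definition proper_digit_set :: "nat set \<Rightarrow> nat \<Rightarrow> bool" where
  "proper_digit_set S b \<longleftrightarrow> S \<subseteq> {0..<b} \<and> 0 \<in> S \<and> S \<noteq> {0..<b}"

text \<open>Only positive differences are considered: reversing a progression with negative
  difference gives one with positive difference and the same terms.\<close>

definition arith_prog :: "nat \<Rightarrow> nat \<Rightarrow> nat \<Rightarrow> nat set" where
  "arith_prog a d k = {a + i * d |i. i < k}"

definition kempner_ap_lengths :: "nat \<Rightarrow> nat set" where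
  "kempner_ap_lengths b =
     {k. \<exists>S a d. proper_digit_set S b \<and> d > 0 \<and> arith_prog a d k \<subseteq> kempner S b}"

text \<open>For \<open>b \<ge> 2\<close> the maximum exists; see \<open>finite_kempner_ap_lengths\<close> and
  \<open>kempner_ap_lengths_nonempty\<close> below.\<close>

definition ell :: "nat \<Rightarrow> nat" where
  "ell b = Max (kempner_ap_lengths b)"

lemma kempner_ap_lengths_nonempty:
  assumes "b \<ge> 2"
  shows "kempner_ap_lengths b \<noteq> {}"
proof -
  have "(1::nat) \<in> {0..<b}" "(1::nat) \<notin> {0}" using assms by auto
  then have "{0} \<noteq> {0..<b}" by blast
  then have "proper_digit_set {0} b"
    using assms unfolding proper_digit_set_def by auto
  then have "0 \<in> kempner_ap_lengths b"
    unfolding kempner_ap_lengths_def arith_prog_def using zero_less_one by blast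
  then show ?thesis by blast
qed

lemma kempner_ap_length_le:
  assumes b: "b \<ge> 2" and k: "k \<in> kempner_ap_lengths b"
  shows "k \<le> 2 * b ^ 2"
proof (rule ccontr)
  assume "\<not> k \<le> 2 * b ^ 2"
  then have k_gt: "k > 2 * b ^ 2" by simp
  from k obtain S a d where S: "proper_digit_set S b" and d: "d > 0"
    and sub: "arith_prog a d k \<subseteq> kempner S b"
    unfolding kempner_ap_lengths_def by blast
  from S have "\<exists>s. s \<in> {0..<b} \<and> s \<notin> S" "0 \<in> S"
    unfolding proper_digit_set_def by blast+
  then obtain s where s: "s < b" "s \<notin> S" "s \<noteq> 0" by auto
  obtain m where m: "b ^ m \<le> d" "d < b ^ Suc m"
    using ex_power_ivl1[of b d] b d by auto
  define B where "B = b ^ Suc m"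
  have B0: "B > 0" using b by (simp add: B_def)
  define q where "q = a div B"
  define T where "T = (q div b + 1) * b + s"
  have T_mod: "T mod b = s" unfolding T_def mod_mult_self3 using s by simp
  have q_eq: "q = q div b * b + q mod b" by simp
  have q_mod: "q mod b < b" using b by simp
  have T_eq: "T = q div b * b + b + s" by (simp add: T_def)
  have qT: "q < T" using q_eq q_mod T_eq by linarith
  have Tq: "T < q + 2 * b" using q_eq T_eq s by linarith
  have Bd: "B \<le> b * d" unfolding B_def using m(1) by simp
  have dB: "d < B" unfolding B_def by (rule m(2))
  define C where "C = T * B"
  have "C * 1 \<le> C * d" using d by (intro mult_left_mono) auto
  then have ex: "C \<le> a + C * d" by linarith
  define i where "i = (LEAST i. C \<le> a + i * d)"
  have i1: "C \<le> a + i * d"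
    unfolding i_def by (rule LeastI[where P = "\<lambda>i. C \<le> a + i * d", OF ex])
  have a_less: "a < C"
    using qT B0 unfolding q_def C_def by (simp add: div_less_iff_less_mult)
  have "i \<noteq> 0"
  proof
    assume "i = 0"
    with i1 have "C \<le> a" by simp
    with a_less show False by simp
  qed
  then obtain j where j: "i = Suc j" using not0_implies_Suc by blast
  have "\<not> C \<le> a + j * d"
    by (rule not_less_Least) (simp only: i_def[symmetric] j lessI)
  then have jl: "a + j * d < C" by simp
  have id: "i * d = j * d + d" by (simp add: j)
  have i2: "a + i * d < C + B" using jl dB id by linarith
  have qa: "q * B \<le> a" unfolding q_def by (rule div_times_less_eq_dividend)
  have "C \<le> (q + 2 * b) * B" unfolding C_def using Tq by (intro mult_le_mono1) simp
  then have "C \<le> q * B + 2 * (b * B)" by (simp only: add_mult_distrib mult.assoc)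
  with jl qa have "j * d < 2 * (b * B)" by linarith
  also have "\<dots> \<le> 2 * (b * (b * d))" using Bd by (intro mult_le_mono2)
  also have "\<dots> = (2 * b ^ 2) * d" by (simp only: power2_eq_square mult.assoc)
  finally have "j < 2 * b ^ 2" by (rule mult_less_cancel2[THEN iffD1, THEN conjunct2])
  then have "i < k" using k_gt j by linarith
  then have inK: "a + i * d \<in> kempner S b" using sub unfolding arith_prog_def by blast
  have "B * T \<le> a + i * d" "a + i * d < B * Suc T"
    using i1 i2 by (simp_all only: C_def mult_Suc_right mult.commute add.commute)
  then have dv: "(a + i * d) div B = T" by (intro div_nat_eqI) (simp_all only: mult.commute)
  have "1 * B \<le> T * B" using qT by (intro mult_le_mono1) simp
  with i1 have "b ^ Suc m \<le> a + i * d" unfolding C_def B_def by linarith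
  moreover have "s = (a + i * d) div b ^ Suc m mod b"
    using dv T_mod unfolding B_def by (simp only:)
  ultimately have "s \<in> base_digits b (a + i * d)"
    unfolding base_digits_def by blast
  then show False using inK s unfolding kempner_def by blast
qed

lemma finite_kempner_ap_lengths:
  assumes "b \<ge> 2"
  shows "finite (kempner_ap_lengths b)"
proof (rule finite_subset)
  show "kempner_ap_lengths b \<subseteq> {..2 * b ^ 2}"
    using kempner_ap_length_le[OF assms] by blast
qed (rule finite_atMost)

definition has_natural_density :: "nat set \<Rightarrow> real \<Rightarrow> bool" where
  "has_natural_density A \<delta> \<longleftrightarrow> (\<lambda>N. real (card (A \<inter> {1..N})) / real N) \<longlonglongrightarrow> \<delta>"

end

theory Submission
  imports Defs "HOL-Analysis.Analysis" "HOL-Number_Theory.Number_Theory"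
begin

text \<open>For every \<open>b \<ge> 2\<close>, \<open>\<ell>(b) \<le> b (b - 1)\<close>: a progression of difference \<open>d\<close> with
  \<open>b\<^sup>m \<le> d < b\<^sup>m\<^sup>+\<^sup>1\<close> cannot jump over a block of length \<open>b\<^sup>m\<^sup>+\<^sup>1\<close> on which digit number \<open>m + 1\<close>
  is the missing one, and two such blocks are \<open>(b - 1) b\<^sup>m\<^sup>+\<^sup>1\<close> apart. Conversely
  \<open>\<ell>(b) \<ge> n (b - 1)\<close> for each \<open>n < b\<close> dividing a power of \<open>b\<close>. If \<open>b\<close> has two distinct prime
  divisors \<open>p, q\<close> from a fixed finite set and is large, some \<open>n = p\<^sup>i q\<^sup>j < b\<close> is close to \<open>b\<close>, because
  \<open>ln p / ln q\<close> is irrational. Finally, there are two coprime moduli \<open>M, M'\<close> such that the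
  integers coprime to \<open>M\<close> or to \<open>M'\<close> have arbitrarily small density, since
  \<open>\<phi>(P!) / P! \<le> 1 / (1 + 1/2 + \<dots> + 1/P)\<close>; all other \<open>b\<close> have such prime divisors.\<close>

subsection \<open>Bounds for progressions in Kempner sets\<close>

text \<open>Every residue recurs within \<open>b\<close> steps above \<open>q\<close>;
  \<open>q mod b \<noteq> s\<close> makes this bound strict, which later yields the factor
  \<open>b - 1\<close> instead of \<open>b\<close>.\<close>

lemma nat_exists_congruent_above:
  fixes q s b :: nat
  assumes "s < b" "q mod b \<noteq> s"
  obtains T where "q < T" "T < q + b" "T mod b = s"
proof -
  have qe: "q = q div b * b + q mod b" and qm: "q mod b < b"
    using assms by simp_all
  show ?thesis
  proof (cases "q mod b < s")
    case True
    show ?thesis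
    proof (rule that)
      show "q < q div b * b + s" using qe True by linarith
      show "q div b * b + s < q + b" using qe assms by linarith
      show "(q div b * b + s) mod b = s" using assms by simp
    qed
  next
    case False
    show ?thesis
    proof (rule that)
      show "q < Suc (q div b) * b + s" using qe qm unfolding mult_Suc by linarith
      show "Suc (q div b) * b + s < q + b" using qe False assms unfolding mult_Suc by linarith
      show "(Suc (q div b) * b + s) mod b = s" using assms(1) by (metis mod_less mod_mult_self3)
    qed
  qed
qed

lemma kempner_ap_length_le_pred:
  assumes b: "b \<ge> 2" and k: "k \<in> kempner_ap_lengths b"
  shows "k \<le> b * (b - 1)"
proof (rule ccontr)
  assume "\<not> k \<le> b * (b - 1)"
  then have k_gt: "b * (b - 1) < k" by simp
  from k obtain S a d where S: "proper_digit_set S b" and d: "d > 0"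
    and sub: "arith_prog a d k \<subseteq> kempner S b"
    unfolding kempner_ap_lengths_def by blast
  from S have "\<exists>s. s \<in> {0..<b} \<and> s \<notin> S" "0 \<in> S"
    unfolding proper_digit_set_def by blast+
  then obtain s where s: "s < b" "s \<notin> S" "s \<noteq> 0" by auto
  obtain m where m: "b ^ m \<le> d" "d < b ^ Suc m"
    using ex_power_ivl1[of b d] b d by auto
  define B where "B = b ^ Suc m"
  have B0: "B > 0" using b by (simp add: B_def)
  have Bd: "B \<le> b * d" and dB: "d < B" unfolding B_def using m by simp_all
  \<comment> \<open>As \<open>s\<close> is nonzero, finding it at position \<open>m + 1\<close>
    forces \<open>B \<le> a + i * d\<close>, so it is a genuine digit and not a leading
    zero.\<close>
  have no_s: "(a + i * d) div B mod b \<noteq> s" if "i < k" for i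
  proof
    assume eq: "(a + i * d) div B mod b = s"
    with s have "(a + i * d) div B \<noteq> 0" by (intro notI) simp
    then have "B \<le> a + i * d" by (simp add: div_eq_0_iff)
    with eq have "s \<in> base_digits b (a + i * d)"
      unfolding base_digits_def B_def by blast
    moreover have "a + i * d \<in> kempner S b"
      using sub that unfolding arith_prog_def by blast
    ultimately show False using s unfolding kempner_def by blast
  qed
  define q where "q = a div B"
  have "q mod b \<noteq> s" using no_s[of 0] k_gt by (simp add: q_def)
  with s obtain T where T: "q < T" "T < q + b" "T mod b = s"
    using nat_exists_congruent_above by blast
  have a_less: "a < T * B"
    using T B0 unfolding q_def by (simp add: div_less_iff_less_mult)
  have qa: "q * B \<le> a" unfolding q_def by (rule div_times_less_eq_dividend)
  have "T * B * 1 \<le> T * B * d" using d by (intro mult_left_mono) auto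
  then have ex: "T * B \<le> a + (T * B) * d" by linarith
  \<comment> \<open>The first term at or beyond \<open>T * B\<close> overshoots by less than
    \<open>d < B\<close>, so it lands inside the forbidden block.\<close>
  define i where "i = (LEAST i. T * B \<le> a + i * d)"
  have i1: "T * B \<le> a + i * d"
    unfolding i_def by (rule LeastI[where P = "\<lambda>i. T * B \<le> a + i * d", OF ex])
  have "i \<noteq> 0" using i1 a_less by (intro notI) simp
  then obtain j where j: "i = Suc j" using not0_implies_Suc by blast
  have "\<not> T * B \<le> a + j * d"
    by (rule not_less_Least) (simp only: i_def[symmetric] j lessI)
  then have jl: "a + j * d < T * B" by simp
  then have i2: "a + i * d < T * B + B" using dB by (simp add: j)
  have "T \<le> q + (b - 1)" using T by linarith
  then have "T * B \<le> q * B + (b - 1) * B" by (metis add_mult_distrib mult_le_mono1)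
  with jl qa have "j * d < (b - 1) * B" by linarith
  also have "\<dots> \<le> (b - 1) * (b * d)" using Bd by (intro mult_le_mono2)
  also have "\<dots> = (b * (b - 1)) * d" by (simp only: mult.assoc mult.left_commute)
  finally have "j < b * (b - 1)" by (rule mult_less_cancel2[THEN iffD1, THEN conjunct2])
  then have "i < k" using k_gt j by linarith
  moreover have "(a + i * d) div B = T"
    using i1 i2 by (intro div_nat_eqI) (simp_all add: mult.commute)
  ultimately show False using no_s T by metis
qed

text \<open>With \<open>d = b\<^sup>t / n\<close> the fractional part of \<open>i d / b\<^sup>t\<close> is a multiple of \<open>1/n\<close>, and so is every
  shift of it by a power of \<open>b\<close>. A digit \<open>b - 1\<close> would make such a fractional part at least
  \<open>1 - 1/b\<close>, but it is at most \<open>1 - 1/n\<close>.\<close>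

lemma kempner_ap_lengths_memI:
  assumes n: "0 < n" "n < b" "n dvd b ^ t"
  shows "n * (b - 1) \<in> kempner_ap_lengths b"
proof (cases "b \<ge> 2")
  case b: True
  define d where "d = b ^ t div n"
  have nd: "n * d = b ^ t" using n by (simp add: d_def)
  have d0: "d > 0" using nd b by (intro Nat.gr0I) simp
  have digit: "(i * d) div b ^ e mod b < b - 1" if i: "i < n * (b - 1)" for i e
  proof (cases "t \<le> e")
    case True
    have "(i * d) div b ^ e \<le> (i * d) div b ^ t"
      using True b by (intro div_le_mono2 power_increasing) auto
    also have "\<dots> = i div n"
      using d0 by (simp add: nd[symmetric])
    also have "\<dots> < b - 1"
      using i n by (simp add: div_less_iff_less_mult mult.commute)
    finally show ?thesis using mod_less_eq_dividend le_less_trans by blast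
  next
    case False
    have "(i * d) div b ^ e mod b \<noteq> b - 1"
    proof
      assume eq: "(i * d) div b ^ e mod b = b - 1"
      define x where "x = i * d"
      define y where "y = x div b ^ e"
      \<comment> \<open>\<open>z\<close> is the distance from \<open>x\<close> to the next multiple
        of \<open>b ^ e\<close>. A digit \<open>b - 1\<close> makes \<open>b ^ Suc e\<close> divide
        \<open>x + z\<close>; it also divides \<open>n * x = i * b ^ t\<close>, hence
        \<open>n * z\<close>, which is positive but too small.\<close>
      define z where "z = b ^ e - x mod b ^ e"
      have z: "0 < z" "z \<le> b ^ e" using b by (simp_all add: z_def)
      have xz: "x + z = (y + 1) * b ^ e"
        using div_mult_mod_eq[of x "b ^ e"] mod_less_divisor[of "b ^ e" x] b
        unfolding y_def z_def by simp
      have "y mod b = b - 1" using eq by (simp add: x_def y_def)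
      then have "y = b * (y div b) + (b - 1)" by (metis mult_div_mod_eq)
      then have "y + 1 = b * (y div b) + b" using b by linarith
      then have "b dvd y + 1" by simp
      then have "b ^ Suc e dvd x + z" unfolding xz power_Suc by (rule mult_dvd_mono) simp
      then have "b ^ Suc e dvd n * x + n * z" by (metis dvd_mult add_mult_distrib2)
      moreover have "b ^ Suc e dvd n * x"
      proof -
        have "n * x = i * b ^ t" by (simp add: x_def nd[symmetric])
        moreover have "b ^ Suc e dvd b ^ t" using False by (intro le_imp_power_dvd) simp
        ultimately show ?thesis by simp
      qed
      ultimately have "b ^ Suc e dvd n * z" by (simp only: dvd_add_right_iff)
      then have "b ^ Suc e \<le> n * z" using n z by (intro dvd_imp_le) auto
      also have "\<dots> \<le> n * b ^ e" using z by simp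
      also have "\<dots> < b * b ^ e" using n b by simp
      finally show False by simp
    qed
    moreover have "(i * d) div b ^ e mod b < b" using b by simp
    ultimately show ?thesis by linarith
  qed
  have "proper_digit_set {0..<b - 1} b"
  proof -
    have "b - 1 \<in> {0..<b}" "b - 1 \<notin> {0..<b - 1}" using b by auto
    then have "{0..<b - 1} \<noteq> {0..<b}" by blast
    then show ?thesis using b unfolding proper_digit_set_def by auto
  qed
  moreover have "arith_prog 0 d (n * (b - 1)) \<subseteq> kempner {0..<b - 1} b"
  proof -
    have "base_digits b (i * d) \<subseteq> {0..<b - 1}" if "i < n * (b - 1)" for i
    proof
      fix c assume "c \<in> base_digits b (i * d)"
      then obtain e where "c = (i * d) div b ^ e mod b" unfolding base_digits_def by blast
      then show "c \<in> {0..<b - 1}" using digit[OF that] by simp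
    qed
    then show ?thesis unfolding arith_prog_def kempner_def by auto
  qed
  ultimately show ?thesis using d0 unfolding kempner_ap_lengths_def by blast
qed (use n in auto)

lemma ell_le:
  assumes "b \<ge> 2"
  shows "ell b \<le> b ^ 2"
proof -
  have "ell b \<in> kempner_ap_lengths b"
    unfolding ell_def using assms
    by (intro Max_in finite_kempner_ap_lengths kempner_ap_lengths_nonempty)
  then have "ell b \<le> b * (b - 1)" using assms kempner_ap_length_le_pred by blast
  also have "\<dots> \<le> b ^ 2" by (simp add: power2_eq_square)
  finally show ?thesis .
qed

lemma ell_ge:
  assumes "0 < n" "n < b" "n dvd b ^ t"
  shows "n * (b - 1) \<le> ell b"
  unfolding ell_def
proof (rule Max_ge)
  show "finite (kempner_ap_lengths b)" using assms by (intro finite_kempner_ap_lengths) linarith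
qed (rule kempner_ap_lengths_memI[OF assms])

subsection \<open>Products of powers of two primes\<close>

text \<open>Dirichlet approximation of \<open>ln p / ln q\<close> with error below
  \<open>1 / N\<close>, scaled by \<open>ln q\<close>. The two powers differ by unique
  factorisation, since the exponent of \<open>p\<close> is positive.\<close>

lemma prime_powers_log_close:
  fixes p q :: nat
  assumes "prime p" "prime q" "p \<noteq> q" "\<epsilon> > 0"
  obtains u v where "p ^ u \<noteq> q ^ v" "\<bar>real u * ln p - real v * ln q\<bar> < \<epsilon>"
proof -
  have p: "ln p > (0::real)" and q: "ln q > (0::real)"
    using assms prime_gt_1_nat by (auto intro!: ln_gt_zero)
  obtain N :: nat where N: "ln q / \<epsilon> < real N" using reals_Archimedean2 by blast
  have N0: "N > 0" by (rule Nat.gr0I) (use N q assms(4) in \<open>simp add: divide_less_0_iff\<close>)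
  obtain h k where hk: "0 < k" "\<bar>of_int k * (ln p / ln q) - of_int h\<bar> < 1 / real N"
    using Dirichlet_approx[OF N0, of "ln p / ln q"] by blast
  \<comment> \<open>The integer \<open>h\<close> is within 1 of a positive number, so it is
    nonnegative and can serve as an exponent.\<close>
  have "of_int k * (ln p / ln q) > (0::real)" using hk p q by simp
  moreover have "1 / real N \<le> 1" using N0 by simp
  ultimately have "of_int h > (-1::real)" using hk(2) by linarith
  then have h: "h \<ge> 0" by linarith
  have eq: "real (nat k) = of_int k" "real (nat h) = of_int h" using hk h by simp_all
  show ?thesis
  proof
    show "p ^ nat k \<noteq> q ^ nat h"
    proof
      assume eq: "p ^ nat k = q ^ nat h"
      have "p dvd p ^ nat k" using hk by simp
      then have "p dvd q" unfolding eq using assms prime_dvd_power by blast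
      then show False using assms primes_dvd_imp_eq by blast
    qed
    have "\<bar>real (nat k) * ln p - real (nat h) * ln q\<bar>
        = \<bar>(of_int k * (ln p / ln q) - of_int h) * ln q\<bar>"
      unfolding eq using q by (simp add: left_diff_distrib)
    also have "\<dots> = \<bar>of_int k * (ln p / ln q) - of_int h\<bar> * ln q" using q by (simp add: abs_mult)
    also have "\<dots> < 1 / real N * ln q" using hk q by (intro mult_strict_right_mono)
    also have "\<dots> < \<epsilon>" using N N0 assms(4) by (simp add: field_simps)
    finally show "\<bar>real (nat k) * ln p - real (nat h) * ln q\<bar> < \<epsilon>" .
  qed
qed

text \<open>Starting from the largest \<open>q\<^sup>w < x\<close>, trade \<open>q\<^sup>v\<close> for \<open>p\<^sup>u\<close> until \<open>x\<close> is reached; the number of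
  trades is bounded independently of \<open>x\<close>.\<close>

lemma eventually_product_of_powers_near:
  fixes p q :: nat
  assumes q: "q \<ge> 2" and less: "q ^ v < p ^ u" and le: "real (p ^ u) \<le> c * real (q ^ v)"
  shows "\<forall>\<^sub>F x :: nat in sequentially. \<exists>i j. p ^ i * q ^ j < x \<and> real x \<le> c * real (p ^ i * q ^ j)"
proof -
  define r where "r = real (p ^ u) / real (q ^ v)"
  have r1: "r > 1"
    using less q unfolding r_def by (metis less_divide_eq_1_pos of_nat_0_less_iff of_nat_less_iff
      pos2 order_less_le_trans zero_less_power)
  have rc: "r \<le> c" using le q by (simp add: r_def divide_le_eq)
  obtain J where J: "real q < r ^ J" using real_arch_pow[OF r1] by blast
  show ?thesis
    \<comment> \<open>This threshold forces \<open>v * J \<le> w\<close>, so the exponent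
      \<open>w - v * j\<close> is never truncated. \<open>J\<close> trades suffice because
      \<open>x \<le> q ^ (w + 1)\<close> and \<open>q < r ^ J\<close>.\<close>
    using eventually_gt_at_top[of "q ^ Suc (v * J)"]
  proof eventually_elim
    case (elim x)
    moreover have "1 \<le> q ^ Suc (v * J)" using q by (intro one_le_power) simp
    ultimately have "2 \<le> x" by linarith
    then obtain w where w: "q ^ w < x" "x \<le> q ^ (w + 1)" using ex_power_ivl2[OF q] by blast
    have "q ^ Suc (v * J) < q ^ Suc w" using elim w(2) by (simp only: Suc_eq_plus1)
    then have wJ: "v * J \<le> w" using q by (subst (asm) power_strict_increasing_iff) auto
    define P where "P = (\<lambda>j. real x \<le> real (q ^ w) * r ^ j)"
    have "real x \<le> real (q ^ w) * real q" using w(2) by (simp flip: of_nat_mult of_nat_power add: mult.commute)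
    also have "\<dots> \<le> real (q ^ w) * r ^ J" using J by (intro mult_left_mono) auto
    finally have PJ: "P J" by (simp add: P_def)
    have nP0: "\<not> P 0" using w(1) by (simp add: P_def not_le flip: of_nat_power)
    obtain j where j: "j < J" "\<not> P j" "P (Suc j)"
      using ex_least_nat_less[of P J] PJ nP0 by blast
    have "v * j \<le> w" using wJ j(1) by (meson le_trans less_imp_le mult_le_mono2)
    then have "real (q ^ w) * r ^ j = real ((p ^ (u * j)) * q ^ (w - v * j))"
      using q by (simp add: r_def power_divide power_diff[where ?'a = real] flip: power_mult)
    moreover have "real x \<le> c * (real (q ^ w) * r ^ j)"
    proof -
      have "real x \<le> r * (real (q ^ w) * r ^ j)" using j(3) by (simp add: P_def mult.left_commute)
      also have "\<dots> \<le> c * (real (q ^ w) * r ^ j)" using rc r1 by (intro mult_right_mono) auto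
      finally show ?thesis .
    qed
    ultimately show ?case using j(2) unfolding P_def by (metis not_le of_nat_less_iff)
  qed
qed

text \<open>Either of the two nearby powers may be the larger one; the conclusion is symmetric in
  \<open>p\<close> and \<open>q\<close>, so their roles can be exchanged.\<close>

lemma eventually_product_of_prime_powers_near:
  fixes p q :: nat
  assumes pq: "prime p" "prime q" "p \<noteq> q" and c: "c > 1"
  shows "\<forall>\<^sub>F x :: nat in sequentially. \<exists>i j. p ^ i * q ^ j < x \<and> real x \<le> c * real (p ^ i * q ^ j)"
proof -
  have le: "real (y ^ m) \<le> c * real (z ^ n)"
    if "real m * ln y - real n * ln z < ln c" "y > 0" "z > 0" for y z m n :: nat
  proof -
    have "ln (real (y ^ m)) \<le> ln (c * real (z ^ n))"
      using that c by (simp add: ln_mult ln_realpow)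
    then show ?thesis using that c by (subst (asm) ln_le_cancel_iff) auto
  qed
  have "ln c > 0" using c by simp
  then obtain u v where uv: "p ^ u \<noteq> q ^ v" "\<bar>real u * ln p - real v * ln q\<bar> < ln c"
    using prime_powers_log_close[OF pq] by blast
  have pq2: "p \<ge> 2" "q \<ge> 2" using pq prime_ge_2_nat by blast+
  show ?thesis
  proof (cases "q ^ v < p ^ u")
    case True
    show ?thesis
      using uv(2) pq2 by (intro eventually_product_of_powers_near[OF _ True] le) auto
  next
    case False
    then have "p ^ u < q ^ v" using uv(1) by simp
    moreover have "real (q ^ v) \<le> c * real (p ^ u)"
      using uv(2) pq2 by (intro le) auto
    ultimately have "\<forall>\<^sub>F x :: nat in sequentially.
        \<exists>i j. q ^ i * p ^ j < x \<and> real x \<le> c * real (q ^ i * p ^ j)"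
      using pq2 by (intro eventually_product_of_powers_near)
    then show ?thesis by eventually_elim (metis mult.commute)
  qed
qed

text \<open>In \<open>n * (b - 1)\<close>, replacing \<open>b\<close> by \<open>n\<close> costs at
  most \<open>\<epsilon> / 2 * b ^ 2\<close>, and the term \<open>- n\<close> costs at most
  \<open>b\<close>, again below \<open>\<epsilon> / 2 * b ^ 2\<close> once
  \<open>b > 2 / \<epsilon>\<close>.\<close>

lemma eventually_ell_close:
  fixes p q :: nat
  assumes pq: "prime p" "prime q" "p \<noteq> q" and e: "\<epsilon> > 0"
  shows "\<forall>\<^sub>F b in sequentially. p dvd b \<longrightarrow> q dvd b \<longrightarrow> \<bar>real (ell b) / real b ^ 2 - 1\<bar> \<le> \<epsilon>"
proof -
  obtain N :: nat where N: "1 / \<epsilon> < real N" using reals_Archimedean2 by blast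
  have "1 + \<epsilon> / 2 > 1" using e by simp
  from eventually_product_of_prime_powers_near[OF pq this]
    eventually_ge_at_top[of 2] eventually_ge_at_top[of "2 * N"]
  show ?thesis
  proof eventually_elim
    case (elim b)
    show ?case
    proof (intro impI)
      assume dvd: "p dvd b" "q dvd b"
      obtain i j where ij: "p ^ i * q ^ j < b" "real b \<le> (1 + \<epsilon> / 2) * real (p ^ i * q ^ j)"
        using elim by blast
      define n where "n = p ^ i * q ^ j"
      have n0: "n > 0" using pq by (simp add: n_def prime_gt_0_nat)
      have "n dvd b ^ (i + j)"
        unfolding n_def power_add using dvd by (intro mult_dvd_mono dvd_power_same)
      then have "n * (b - 1) \<le> ell b" using ij n0 by (intro ell_ge) (auto simp: n_def)
      then have ell: "real n * (real b - 1) \<le> real (ell b)"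
        using of_nat_mono[where ?'a = real, of "n * (b - 1)" "ell b"] elim(2) by (simp add: of_nat_diff)
      have b: "real b > 0" "real b * \<epsilon> > 2"
      proof -
        show "real b > 0" using elim(2) by simp
        have "2 < 2 * real N * \<epsilon>" using N e by (simp add: field_simps)
        also have "\<dots> \<le> real b * \<epsilon>" using elim(3) e by (intro mult_right_mono) linarith+
        finally show "real b * \<epsilon> > 2" .
      qed
      have "real n \<le> real b" using ij(1) unfolding n_def by linarith
      then have "real n * \<epsilon> \<le> real b * \<epsilon>" using e by (intro mult_right_mono) auto
      moreover have "real b \<le> real n + real n * \<epsilon> / 2" using ij(2) by (simp add: n_def algebra_simps)
      ultimately have "real b - real n \<le> real b * \<epsilon> / 2" by linarith
      then have "real b * (real b - real n) \<le> real b * (real b * \<epsilon> / 2)"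
        using b by (intro mult_left_mono) auto
      moreover have "real b * 2 \<le> real b * (real b * \<epsilon>)" using b by (intro mult_left_mono) auto
      moreover have "real n * (real b - 1) = real b * real b - real b * (real b - real n) - real n"
        by (simp add: algebra_simps)
      ultimately have "real b * real b - real b * (real b * \<epsilon>) \<le> real (ell b)"
        using ell \<open>real n \<le> real b\<close> by linarith
      then have "1 - \<epsilon> \<le> real (ell b) / real b ^ 2"
        using b by (simp add: field_simps power2_eq_square)
      moreover have "real (ell b) / real b ^ 2 \<le> 1"
      proof -
        have "real (ell b) \<le> real (b ^ 2)" using ell_le elim by (simp only: of_nat_le_iff)
        then show ?thesis using b by (simp add: field_simps)
      qed
      ultimately show "\<bar>real (ell b) / real b ^ 2 - 1\<bar> \<le> \<epsilon>" by linarith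
    qed
  qed
qed

subsection \<open>Integers coprime to a given modulus\<close>

lemma prod_le_prod_subset:
  fixes f :: "'a \<Rightarrow> 'b :: linordered_idom"
  assumes "finite B" "A \<subseteq> B" and f: "\<And>b. b \<in> B \<Longrightarrow> 0 \<le> f b" "\<And>b. b \<in> B \<Longrightarrow> f b \<le> 1"
  shows "prod f B \<le> prod f A"
proof -
  have "prod f B = prod f (B - A) * prod f A"
    using assms by (metis prod.subset_diff)
  also have "\<dots> \<le> 1 * prod f A"
    using assms by (intro mult_right_mono prod_le_1 prod_nonneg) auto
  finally show ?thesis by simp
qed

lemma not_coprime_nat_obtains_prime:
  fixes a b :: nat
  assumes "\<not> coprime a b"
  obtains p where "prime p" "p dvd a" "p dvd b"
proof -
  have "gcd a b \<noteq> 1" using assms coprime_iff_gcd_eq_1 by blast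
  then obtain p where "prime p" "p dvd gcd a b" using prime_factor_nat by blast
  then show ?thesis using that by simp
qed

text \<open>By Euler's product over prime divisors, passing to a divisor only drops factors that are
  at most 1.\<close>

lemma totient_ratio_antimono:
  assumes "d dvd n" "n > 0"
  shows "real (totient n) / real n \<le> real (totient d) / real d"
proof -
  have d: "d > 0" using assms by (auto intro: Nat.gr0I)
  have "(\<Prod>p\<in>prime_factors n. 1 - 1 / real p) \<le> (\<Prod>p\<in>prime_factors d. 1 - 1 / real p)"
    using assms
    by (intro prod_le_prod_subset dvd_prime_factors)
       (auto simp: prime_ge_Suc_0_nat Suc_le_eq prime_gt_0_nat dest!: in_prime_factors_imp_prime)
  then show ?thesis using assms d by (simp add: totient_formula2)
qed

text \<open>Combine \<open>n = \<Sum>d | d dvd n. \<phi>(d)\<close> with \<open>\<phi>(d) \<ge> d \<phi>(n) / n\<close>, for \<open>n = P!\<close>; the divisors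
  \<open>n / k\<close> with \<open>k \<le> P\<close> contribute the harmonic sum.\<close>

lemma totient_fact_ratio_le:
  assumes "P > 0"
  shows "real (totient (fact P)) / real (fact P) \<le> 1 / harm P"
proof -
  define n :: nat where "n = fact P"
  have n0: "n > 0" by (simp add: n_def)
  define D where "D = real (totient n) / real n"
  have D0: "D \<ge> 0" by (simp add: D_def)
  have dvd: "k dvd n" if "k \<in> {1..P}" for k using that by (simp add: n_def dvd_fact)
  have "D * harm P * real n = D * (\<Sum>k\<in>{1..P}. real (n div k))"
    unfolding harm_def mult.assoc sum_distrib_right
    using dvd by (intro arg_cong[where f = "(*) D"] sum.cong) (simp_all add: real_of_nat_div divide_inverse mult.commute)
  also have "(\<Sum>k\<in>{1..P}. real (n div k)) = (\<Sum>d\<in>(\<lambda>k. n div k) ` {1..P}. real d)"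
  proof (subst sum.reindex)
    show "inj_on (\<lambda>k. n div k) {1..P}"
    proof (rule inj_onI)
      fix k l assume kl: "k \<in> {1..P}" "l \<in> {1..P}" "n div k = n div l"
      have "n div k * k = n div k * l" using dvd kl by (metis dvd_div_mult_self)
      moreover have "n div k > 0" using dvd[OF kl(1)] kl(1) n0 by (auto intro: Nat.gr0I elim!: dvdE)
      ultimately show "k = l" by simp
    qed
  qed simp
  also have "\<dots> \<le> (\<Sum>d | d dvd n. real d)"
    using n0 dvd by (intro sum_mono2) (auto dest!: dvd intro: div_dvd_iff_mult[THEN iffD2])
  also have "D * (\<Sum>d | d dvd n. real d) = (\<Sum>d | d dvd n. D * real d)"
    by (simp add: sum_distrib_left)
  also have "\<dots> \<le> (\<Sum>d | d dvd n. real (totient d))"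
  proof (rule sum_mono)
    fix d assume "d \<in> {d. d dvd n}"
    then have "D \<le> real (totient d) / real d" and "d > 0"
      unfolding D_def using totient_ratio_antimono n0 by (auto intro: Nat.gr0I)
    then show "D * real d \<le> real (totient d)" by (simp add: field_simps)
  qed
  also have "\<dots> = real n" by (simp flip: of_nat_sum add: totient_divisor_sum)
  finally have "D * harm P \<le> 1" using D0 n0 by (simp add: mult_left_mono)
  then show ?thesis using harm_pos[OF assms, where ?'a = real] by (simp add: D_def n_def field_simps)
qed

text \<open>Take the product of the primes dividing \<open>P!\<close> but not \<open>m\<close>.
  Omitting the primes of \<open>m\<close> raises the ratio by at most the factor
  \<open>1 / h A\<close>, independent of \<open>P\<close>, which the divergent harmonic sum
  outweighs.\<close>

lemma exists_coprime_small_totient_ratio: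
  assumes "m > 0" "\<epsilon> > 0"
  obtains M where "M > 0" "coprime m M" "real (totient M) / real M < \<epsilon>"
proof -
  define h where "h = (\<lambda>A. \<Prod>p\<in>A. 1 - 1 / real p)"
  have tot: "real (totient n) / real n = h (prime_factors n)" if "n > 0" for n
    using that by (simp add: totient_formula2 h_def)
  have pos: "h A > 0" if "\<And>p. p \<in> A \<Longrightarrow> prime p" for A
    unfolding h_def using that by (intro prod_pos) (auto dest!: that prime_gt_1_nat)
  define A where "A = prime_factors m"
  have A: "finite A" "\<And>p. p \<in> A \<Longrightarrow> prime p" by (auto simp: A_def)
  have "\<forall>\<^sub>F P in sequentially. harm P > 1 / (\<epsilon> * h A)"
    using harm_at_top unfolding filterlim_at_top_dense by blast
  then obtain P where P: "P > 0" "harm P > 1 / (\<epsilon> * h A)"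
    using eventually_gt_at_top[of 0] by (metis (mono_tags, lifting) eventually_conj eventually_happens' sequentially_bot)
  define B where "B = prime_factors (fact P :: nat)"
  have B: "finite B" "\<And>p. p \<in> B \<Longrightarrow> prime p" by (auto simp: B_def)
  define M where "M = \<Prod>(B - A)"
  have M0: "M > 0" unfolding M_def using B by (intro prod_pos) (auto simp: prime_gt_0_nat)
  have pf: "prime_factors M = B - A"
    unfolding M_def using B
    by (subst prime_factors_prod) (auto simp: prime_prime_factors dest: not_prime_0[THEN notE])
  have "h (B - A) * h A \<le> h (B - A) * h (B \<inter> A)"
  proof (rule mult_left_mono)
    show "h A \<le> h (B \<inter> A)"
      unfolding h_def using A
      by (intro prod_le_prod_subset) (auto simp: Suc_le_eq prime_gt_0_nat)
  qed (use B pos[of "B - A"] in auto)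
  also have "\<dots> = h B"
    unfolding h_def using B by (subst prod.union_disjoint[symmetric]) (auto intro: prod.cong)
  also have "\<dots> \<le> 1 / harm P"
    using totient_fact_ratio_le[OF P(1)] tot[of "fact P"] by (simp add: B_def)
  also have "\<dots> < \<epsilon> * h A"
    using P assms pos[OF A(2)] harm_pos[OF P(1), where ?'a = real] by (simp add: field_simps)
  finally have "h (B - A) < \<epsilon>" using pos[OF A(2)] by (simp add: mult_less_cancel_right_pos)
  moreover have "coprime m M"
  proof (rule ccontr)
    assume "\<not> coprime m M"
    then obtain p where "prime p" "p dvd m" "p dvd M" by (rule not_coprime_nat_obtains_prime)
    then have "p \<in> prime_factors m" "p \<in> prime_factors M"
      using assms M0 by (auto simp: prime_factors_dvd)
    then show False using pf by (simp add: A_def)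
  qed
  ultimately show ?thesis using that tot[OF M0] M0 pf by simp
qed

text \<open>Division with remainder maps injectively to pairs of a quotient and a totative. The
  modulus 1 is separate: its remainder is 0, but its only totative is 1.\<close>

lemma card_coprime_le:
  assumes "M > 0"
  shows "card {b \<in> {1..N}. coprime b M} \<le> (N div M + 1) * totient M"
proof (cases "M = 1")
  case False
  with assms have M: "M > 1" by simp
  have "card {b \<in> {1..N}. coprime b M} \<le> card ({..N div M} \<times> totatives M)"
  proof (rule card_inj_on_le)
    show "inj_on (\<lambda>b. (b div M, b mod M)) {b \<in> {1..N}. coprime b M}"
      by (rule inj_onI) (metis div_mod_decomp prod.inject)
    show "(\<lambda>b. (b div M, b mod M)) ` {b \<in> {1..N}. coprime b M} \<subseteq> {..N div M} \<times> totatives M"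
    proof clarsimp
      fix b assume b: "b \<le> N" "coprime b M"
      then have "coprime (b mod M) M" using assms by simp
      then have "b mod M > 0" using M by (intro Nat.gr0I) simp
      then show "b div M \<le> N div M \<and> b mod M \<in> totatives M"
        using b assms \<open>coprime (b mod M) M\<close> by (simp add: div_le_mono in_totatives_iff less_imp_le)
    qed
  qed simp
  then show ?thesis by (simp add: card_cartesian_product totient_def)
next
  case True
  have "card {b \<in> {1..N}. coprime b M} \<le> card {1..N}" by (intro card_mono) auto
  then show ?thesis using True by simp
qed

text \<open>The incomplete last block adds at most the constant \<open>totient M\<close>, absorbed
  by the slack \<open>(\<epsilon> - D) * N\<close>.\<close>

lemma eventually_card_coprime_le:
  assumes "M > 0" "real (totient M) / real M < \<epsilon>"
  shows "\<forall>\<^sub>F N in sequentially. real (card {b \<in> {1..N}. coprime b M}) \<le> \<epsilon> * real N"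
proof -
  define D where "D = real (totient M) / real M"
  obtain N0 :: nat where N0: "real (totient M) / (\<epsilon> - D) < real N0"
    using reals_Archimedean2 by blast
  show ?thesis
    using eventually_ge_at_top[of N0]
  proof eventually_elim
    case (elim N)
    have "real (card {b \<in> {1..N}. coprime b M}) \<le> real ((N div M + 1) * totient M)"
      using card_coprime_le[OF assms(1)] by (simp only: of_nat_le_iff)
    also have "\<dots> = (real (N div M) + 1) * real (totient M)"
      by (simp add: algebra_simps)
    also have "\<dots> \<le> (real N / real M + 1) * real (totient M)"
      by (intro mult_right_mono add_mono of_nat_div_le_of_nat) auto
    also have "\<dots> = D * real N + real (totient M)" by (simp add: D_def field_simps)
    also have "real (totient M) \<le> (\<epsilon> - D) * real N0"
      using N0 assms by (simp add: D_def field_simps)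
    also have "\<dots> \<le> (\<epsilon> - D) * real N"
      using elim assms by (intro mult_left_mono) (auto simp: D_def)
    finally show ?case by (simp add: algebra_simps)
  qed
qed

text \<open>Exceptional \<open>b\<close> are below a threshold \<open>X\<close>, coprime to
  \<open>M\<close>, or coprime to \<open>M'\<close>, each class costing \<open>\<eta> / 3\<close>.
  \<open>X\<close> is uniform because only finitely many prime pairs occur.\<close>

lemma eventually_card_ell_far_le:
  assumes "\<epsilon> > 0" "\<eta> > 0"
  shows "\<forall>\<^sub>F N in sequentially.
    real (card {b \<in> {1..N}. \<bar>real (ell b) / real b ^ 2 - 1\<bar> > \<epsilon>}) \<le> \<eta> * real N"
proof -
  define E where "E = {b. \<bar>real (ell b) / real b ^ 2 - 1\<bar> > \<epsilon>}"
  have \<eta>3: "\<eta> / 3 > 0" using assms by simp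
  obtain M where M: "M > 0" "real (totient M) / real M < \<eta> / 3"
    using exists_coprime_small_totient_ratio[of 1, OF _ \<eta>3] by auto
  obtain M' where M': "M' > 0" "coprime M M'" "real (totient M') / real M' < \<eta> / 3"
    using exists_coprime_small_totient_ratio[OF M(1) \<eta>3] by blast
  have "\<forall>\<^sub>F b in sequentially. \<forall>p\<in>prime_factors M. \<forall>q\<in>prime_factors M'.
      p dvd b \<longrightarrow> q dvd b \<longrightarrow> \<bar>real (ell b) / real b ^ 2 - 1\<bar> \<le> \<epsilon>"
  proof (intro eventually_ball_finite ballI)
    fix p q assume "p \<in> prime_factors M" "q \<in> prime_factors M'"
    then have "prime p" "prime q" "p dvd M" "q dvd M'" by auto
    moreover from this have "p \<noteq> q" using M'(2) by (metis coprime_common_divisor not_prime_unit)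
    ultimately show "\<forall>\<^sub>F b in sequentially. p dvd b \<longrightarrow> q dvd b \<longrightarrow>
        \<bar>real (ell b) / real b ^ 2 - 1\<bar> \<le> \<epsilon>"
      using eventually_ell_close assms by blast
  qed auto
  then obtain X where X: "\<And>b p q. \<lbrakk>b \<ge> X; p \<in> prime_factors M; q \<in> prime_factors M'; p dvd b;
      q dvd b\<rbrakk> \<Longrightarrow> b \<notin> E"
    unfolding eventually_sequentially E_def by (auto simp: not_less)
  obtain N0 :: nat where N0: "real X / (\<eta> / 3) < real N0" using reals_Archimedean2 by blast
  have prime_dvd: "\<exists>p\<in>prime_factors L. p dvd b" if "\<not> coprime b L" "L > 0" for b L :: nat
    using that by (elim not_coprime_nat_obtains_prime) (auto simp: prime_factors_dvd)
  show ?thesis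
    using eventually_card_coprime_le[OF M] eventually_card_coprime_le[OF M'(1,3)]
      eventually_ge_at_top[of N0]
  proof eventually_elim
    case (elim N)
    have "{b \<in> {1..N}. b \<in> E} \<subseteq>
        {..<X} \<union> ({b \<in> {1..N}. coprime b M} \<union> {b \<in> {1..N}. coprime b M'})"
      using X prime_dvd M(1) M'(1) by (auto simp: not_less) (meson not_le)+
    then have "card {b \<in> {1..N}. b \<in> E} \<le>
        card ({..<X} \<union> ({b \<in> {1..N}. coprime b M} \<union> {b \<in> {1..N}. coprime b M'}))"
      by (intro card_mono) auto
    also have "\<dots> \<le> X + (card {b \<in> {1..N}. coprime b M} + card {b \<in> {1..N}. coprime b M'})"
      by (intro order_trans[OF card_Un_le] add_mono) auto
    finally have "real (card {b \<in> {1..N}. b \<in> E}) \<le>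
        real X + (real (card {b \<in> {1..N}. coprime b M}) + real (card {b \<in> {1..N}. coprime b M'}))"
      by linarith
    moreover have "real X \<le> \<eta> / 3 * real N0" using N0 assms by (simp add: field_simps)
    moreover have "\<eta> / 3 * real N0 \<le> \<eta> / 3 * real N" using elim(3) assms by (intro mult_left_mono) auto
    ultimately have "real (card {b \<in> {1..N}. b \<in> E}) \<le> \<eta> * real N" using elim by linarith
    then show ?case by (simp add: E_def)
  qed
qed

subsection \<open>Convergence along a set of density one\<close>

text \<open>Diagonal argument: the exceptional set \<open>E k\<close> for tolerance \<open>1 / (k + 1)\<close> has at most
  \<open>N / (k + 1)\<close> elements up to \<open>N\<close> once \<open>N \<ge> start k\<close>, and \<open>b\<close> is excluded from \<open>A\<close> if it lies in
  \<open>E (level b)\<close>. As \<open>E\<close> and \<open>level\<close> are increasing, all exclusions up to \<open>N\<close> lie in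
  \<open>E (level N)\<close>.\<close>

lemma density_one_convergence:
  fixes f :: "nat \<Rightarrow> real"
  assumes "\<And>\<epsilon> \<eta>. \<lbrakk>\<epsilon> > 0; \<eta> > 0\<rbrakk> \<Longrightarrow>
    \<forall>\<^sub>F N in sequentially. real (card {b \<in> {1..N}. \<bar>f b - L\<bar> > \<epsilon>}) \<le> \<eta> * real N"
  shows "\<exists>A. (\<forall>b\<in>A. b > 0) \<and> has_natural_density A 1 \<and> (f \<longlongrightarrow> L) (inf at_top (principal A))"
proof -
  define E where "E = (\<lambda>k. {b. \<bar>f b - L\<bar> > 1 / real (Suc k)})"
  have E_mono: "E k \<subseteq> E l" if "k \<le> l" for k l
  proof -
    have "1 / real (Suc l) \<le> 1 / real (Suc k)" using that by (simp add: field_simps)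
    then show ?thesis unfolding E_def by auto
  qed
  have "\<forall>k. \<exists>n. \<forall>N\<ge>n. real (card {b \<in> {1..N}. b \<in> E k}) \<le> 1 / real (Suc k) * real N"
    using assms[of "1 / real (Suc k)" "1 / real (Suc k)" for k]
    unfolding eventually_sequentially E_def by simp
  then obtain start where start: "\<And>k N. N \<ge> start k \<Longrightarrow>
      real (card {b \<in> {1..N}. b \<in> E k}) \<le> 1 / real (Suc k) * real N" by metis
  \<comment> \<open>The condition \<open>k \<le> b\<close> keeps the set finite, and inserting 0
    keeps it nonempty, so \<open>Max\<close> is meaningful.\<close>
  define level where "level = (\<lambda>b. Max (insert 0 {k. k \<le> b \<and> start k \<le> b}))"
  have level_ge: "k \<le> level b" if "k \<le> b" "start k \<le> b" for k b
    unfolding level_def using that by (intro Max_ge) auto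
  have level_mono: "level b \<le> level N" if "b \<le> N" for b N
    unfolding level_def using that by (intro Max_mono) auto
  have level_mem: "level b \<in> insert 0 {k. k \<le> b \<and> start k \<le> b}" for b
    unfolding level_def by (intro Max_in) auto
  have level_lim: "filterlim level at_top sequentially"
    unfolding filterlim_at_top
  proof
    fix k
    show "\<forall>\<^sub>F b in sequentially. k \<le> level b"
      using eventually_ge_at_top[of k] eventually_ge_at_top[of "start k"]
      by eventually_elim (rule level_ge)
  qed
  have inv_lim: "(\<lambda>b. 1 / real (Suc (level b))) \<longlonglongrightarrow> 0"
    using filterlim_compose[OF LIMSEQ_Suc[OF lim_1_over_n] level_lim] by simp
  define A where "A = {b. b > 0 \<and> b \<notin> E (level b)}"
  have card_A: "1 - 1 / real (Suc (level N)) \<le> real (card (A \<inter> {1..N})) / real N"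
    "real (card (A \<inter> {1..N})) / real N \<le> 1" if N: "N > 0" for N
  proof -
    have sub: "{1..N} - A \<subseteq> {b \<in> {1..N}. b \<in> E (level N)}"
    proof
      fix x assume x: "x \<in> {1..N} - A"
      then have "x \<in> E (level x)" by (auto simp: A_def)
      then show "x \<in> {b \<in> {1..N}. b \<in> E (level N)}" using x E_mono[OF level_mono[of x N]] by auto
    qed
    have "real (card ({1..N} - A)) \<le> 1 / real (Suc (level N)) * real N"
    proof (cases "level N = 0")
      \<comment> \<open>At level 0 the bound \<open>start 0\<close> may not have been reached, but
        the claim is then just that at most \<open>N\<close> elements are excluded.\<close>
      case True
      have "card ({1..N} - A) \<le> card {1..N}" by (intro card_mono) auto
      then show ?thesis using True by simp
    next
      case False
      have "card ({1..N} - A) \<le> card {b \<in> {1..N}. b \<in> E (level N)}" using sub by (intro card_mono) auto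
      then have "real (card ({1..N} - A)) \<le> real (card {b \<in> {1..N}. b \<in> E (level N)})" by simp
      also have "\<dots> \<le> 1 / real (Suc (level N)) * real N"
        using level_mem[of N] False by (intro start) auto
      finally show ?thesis .
    qed
    moreover have "card {1..N} = card (A \<inter> {1..N}) + card ({1..N} - A)"
      using card_Int_Diff[of "{1..N}" A] by (simp add: Int_commute)
    then have "real N = real (card (A \<inter> {1..N})) + real (card ({1..N} - A))" by simp
    ultimately have "real N - 1 / real (Suc (level N)) * real N \<le> real (card (A \<inter> {1..N}))"
      "real (card (A \<inter> {1..N})) \<le> real N" by linarith+
    then show "1 - 1 / real (Suc (level N)) \<le> real (card (A \<inter> {1..N})) / real N"
      "real (card (A \<inter> {1..N})) / real N \<le> 1"
      using N by (simp_all add: pos_le_divide_eq left_diff_distrib)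
  qed
  have "has_natural_density A 1"
    unfolding has_natural_density_def
  proof (rule tendsto_sandwich)
    show "\<forall>\<^sub>F N in sequentially. 1 - 1 / real (Suc (level N)) \<le> real (card (A \<inter> {1..N})) / real N"
      using eventually_gt_at_top[of 0] by eventually_elim (rule card_A)
    show "\<forall>\<^sub>F N in sequentially. real (card (A \<inter> {1..N})) / real N \<le> 1"
      using eventually_gt_at_top[of 0] by eventually_elim (rule card_A)
    show "(\<lambda>N. 1 - 1 / real (Suc (level N))) \<longlonglongrightarrow> 1"
      using tendsto_diff[OF tendsto_const inv_lim, of 1] by simp
  qed simp
  moreover have "(f \<longlongrightarrow> L) (inf at_top (principal A))"
  proof (subst LIM_zero_iff[symmetric])
    have "\<forall>\<^sub>F b in inf at_top (principal A). norm (f b - L) \<le> 1 / real (Suc (level b))"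
      unfolding eventually_inf_principal by (auto simp: A_def E_def not_less)
    then show "((\<lambda>b. f b - L) \<longlongrightarrow> 0) (inf at_top (principal A))"
      by (rule Lim_null_comparison) (rule tendsto_mono[OF inf_le1 inv_lim])
  qed
  moreover have "\<forall>b\<in>A. b > 0" by (simp add: A_def)
  ultimately show ?thesis by (intro exI[of _ A] conjI)
qed

theorem theorem1p2:
  "\<exists>A :: nat set. (\<forall>b\<in>A. b > 0) \<and> has_natural_density A 1 \<and>
     ((\<lambda>b. real (ell b) / real b ^ 2) \<longlongrightarrow> 1) (inf at_top (principal A))"
  by (intro density_one_convergence eventually_card_ell_far_le)

end
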